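(* Let $f(x)=1/x$ for $x>0$. Then $pf(php)p\le f(h)$ for all projections $p$ and all positive invertible operators $h$ (with $p,h$ acting on the same Hilbert space).
   Context: Operators are bounded operators on (arbitrary, complex) Hilbert spaces (they may be assumed to be finite matrices); $f(h)=h^{-1}$ for positive invertible $h$; $\le$ is the usual order on self-adjoint operators. Projection means self-adjoint idempotent. For a projection $p$ and a positive invertible $h$ on a Hilbert space $H$, $pf(php)p$ denotes the operator which on the range $pH$ of $p$ equals $f$ applied to the compression of $h$ to $pH$ (i.e. the inverse on $pH$ of the positive invertible operator $php|_{pH}$), and which is $0$ on $(1-p)H$. *)

theory Defs
  imports "HOL-Analysis.Analysis"
begin

text \<open>
  Complex Hilbert spaces of arbitrary dimension. The underlying real Hilbert space structure
  (norm, topology, completeness, real inner product) is that of the library; it is determined by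
  the complex inner product, whose real part is the real inner product. The complex inner
  product is antilinear in its first argument.
\<close>

class complex_hilbert_space = real_inner + complete_space +
  fixes scaleC :: "complex \<Rightarrow> 'a \<Rightarrow> 'a" (infixr "*\<^sub>C" 75)
    and cinner :: "'a \<Rightarrow> 'a \<Rightarrow> complex"
  assumes scaleC_add_right: "c *\<^sub>C (x + y) = c *\<^sub>C x + c *\<^sub>C y"
    and scaleC_add_left: "(c + d) *\<^sub>C x = c *\<^sub>C x + d *\<^sub>C x"
    and scaleC_scaleC: "c *\<^sub>C (d *\<^sub>C x) = (c * d) *\<^sub>C x"
    and scaleC_of_real: "complex_of_real r *\<^sub>C x = r *\<^sub>R x"
    and cinner_commute: "cinner y x = cnj (cinner x y)"
    and cinner_add_right: "cinner x (y + z) = cinner x y + cinner x z"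
    and cinner_scaleC_right: "cinner x (c *\<^sub>C y) = c * cinner x y"
    and Re_cinner: "Re (cinner x y) = inner x y"

lemma cinner_self: "cinner x x = complex_of_real ((norm x)\<^sup>2)"
proof (rule complex_eqI)
  show "Im (cinner x x) = Im (complex_of_real ((norm x)\<^sup>2))"
    using arg_cong[OF cinner_commute[of x x], of Im] by simp
qed (simp add: Re_cinner power2_norm_eq_inner)

instantiation complex :: complex_hilbert_space
begin

definition scaleC_complex :: "complex \<Rightarrow> complex \<Rightarrow> complex"
  where "scaleC_complex c x = c * x"

definition cinner_complex :: "complex \<Rightarrow> complex \<Rightarrow> complex"
  where "cinner_complex x y = cnj x * y"

instance
  by standard
    (simp_all add: scaleC_complex_def cinner_complex_def algebra_simps scaleR_conv_of_real
      inner_complex_def)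

end

instantiation vec :: (complex_hilbert_space, finite) complex_hilbert_space
begin

definition scaleC_vec :: "complex \<Rightarrow> 'a ^ 'b \<Rightarrow> 'a ^ 'b"
  where "scaleC_vec c x = (\<chi> i. c *\<^sub>C (x $ i))"

definition cinner_vec :: "'a ^ 'b \<Rightarrow> 'a ^ 'b \<Rightarrow> complex"
  where "cinner_vec x y = (\<Sum>i\<in>UNIV. cinner (x $ i) (y $ i))"

instance
proof
  fix x y :: "'a ^ 'b"
  show "cinner y x = cnj (cinner x y)"
    unfolding cinner_vec_def cnj_sum by (intro sum.cong refl cinner_commute)
qed (simp_all add: scaleC_vec_def cinner_vec_def vec_eq_iff scaleC_add_right scaleC_add_left
      scaleC_scaleC scaleC_of_real cinner_add_right cinner_scaleC_right Re_cinner
      inner_vec_def sum.distrib sum_distrib_left)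

end

definition bounded_op :: "('a::complex_hilbert_space \<Rightarrow> 'a) \<Rightarrow> bool"
  where "bounded_op a \<longleftrightarrow> bounded_linear a \<and> (\<forall>c x. a (c *\<^sub>C x) = c *\<^sub>C a x)"

definition selfadjoint_op :: "('a::complex_hilbert_space \<Rightarrow> 'a) \<Rightarrow> bool"
  where "selfadjoint_op a \<longleftrightarrow> bounded_op a \<and> (\<forall>x y. cinner (a x) y = cinner x (a y))"

definition projection_op :: "('a::complex_hilbert_space \<Rightarrow> 'a) \<Rightarrow> bool"
  where "projection_op p \<longleftrightarrow> selfadjoint_op p \<and> p \<circ> p = p"

text \<open>For self-adjoint \<open>a\<close> the number \<open>cinner x (a x)\<close> is real, so its real part is all of it.\<close>

definition positive_op :: "('a::complex_hilbert_space \<Rightarrow> 'a) \<Rightarrow> bool"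
  where "positive_op a \<longleftrightarrow> selfadjoint_op a \<and> (\<forall>x. 0 \<le> Re (cinner x (a x)))"

definition invertible_op :: "('a::complex_hilbert_space \<Rightarrow> 'a) \<Rightarrow> bool"
  where "invertible_op a \<longleftrightarrow> bounded_op a \<and> (\<exists>b. bounded_op b \<and> a \<circ> b = id \<and> b \<circ> a = id)"

definition op_le :: "('a::complex_hilbert_space \<Rightarrow> 'a) \<Rightarrow> ('a \<Rightarrow> 'a) \<Rightarrow> bool"  (infix "\<le>\<^sub>o\<^sub>p" 50)
  where "a \<le>\<^sub>o\<^sub>p b \<longleftrightarrow> selfadjoint_op a \<and> selfadjoint_op b \<and> positive_op (\<lambda>x. b x - a x)"

text \<open>
  For \<open>f(x) = 1/x\<close> and a positive invertible \<open>h\<close>, the operator \<open>f(h)\<close> is \<open>inv h\<close>. The operator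
  \<open>pf(php)p\<close> sends \<open>x\<close> to the preimage of \<open>p x\<close> under the compression of \<open>h\<close> to \<open>range p\<close>:
  on \<open>range p\<close> it is the inverse of the compression, and it vanishes on the range of \<open>1 - p\<close>,
  which is the kernel of \<open>p\<close>.
\<close>

definition compression_inverse ::
    "('a::complex_hilbert_space \<Rightarrow> 'a) \<Rightarrow> ('a \<Rightarrow> 'a) \<Rightarrow> 'a \<Rightarrow> 'a"
  where "compression_inverse p h x = inv_into (range p) (p \<circ> h \<circ> p) (p x)"

end

theory Submission
  imports Defs
begin

text \<open>
  The inequality is a variational fact. Put \<open>v = h\<^sup>-\<^sup>1 x\<close> and let \<open>u\<close> be the value of \<open>p f(php) p\<close>
  at \<open>x\<close>, so that \<open>u\<close> lies in the range of \<open>p\<close> and \<open>p h u = p x = p h v\<close>. In the inner product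
  \<open>\<langle>h a, b\<rangle>\<close> this says that \<open>u\<close> is the orthogonal projection of \<open>v\<close> onto the range of \<open>p\<close>. Hence
  \<open>\<langle>x, v\<rangle> - \<langle>x, u\<rangle> = \<langle>h v, v\<rangle> - \<langle>h u, u\<rangle> = \<langle>h (v - u), v - u\<rangle> \<ge> 0\<close>.

  For this argument the vector \<open>u\<close> has to exist, be unique and depend boundedly on \<open>x\<close>. All three
  come from coercivity: a positive invertible \<open>h\<close> satisfies \<open>c \<parallel>x\<parallel>\<^sup>2 \<le> \<langle>x, h x\<rangle>\<close> for some \<open>c > 0\<close>
  (lemma \<open>positive_invertible_coercive\<close>). Coercivity passes to compressions, and a coercive bounded
  operator on a Hilbert space is onto (lemma \<open>coercive_surj\<close>, the existence half of the
  Lax-Milgram theorem). The resulting characterisation of \<open>u\<close> is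
  \<open>compression_inverse_eq_iff\<close>.
\<close>

section \<open>Bounded and self-adjoint operators\<close>

lemma cinner_diff_right: "cinner x (y - z) = cinner x y - cinner x z"
  using cinner_add_right[of x "y - z" z] by (simp add: algebra_simps)

lemma cinner_diff_left: "cinner (x - y) z = cinner x z - cinner y z"
  by (metis cinner_commute cinner_diff_right complex_cnj_diff)

lemma scaleC_diff_right: "c *\<^sub>C (x - y) = c *\<^sub>C x - c *\<^sub>C y"
  using scaleC_add_right[of c "x - y" y] by (simp add: algebra_simps)

lemma bounded_op_intro:
  assumes "\<And>x y. a (x + y) = a x + a y"
    and "\<And>c x. a (c *\<^sub>C x) = c *\<^sub>C a x"
    and "\<And>x. norm (a x) \<le> norm x * K"
  shows "bounded_op a"
  unfolding bounded_op_def
proof (intro conjI allI)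
  show "bounded_linear a"
    using assms by (intro bounded_linear_intro[where K = K]) (simp_all flip: scaleC_of_real)
qed (rule assms(2))

lemma bounded_op_diff:
  assumes "bounded_op a" "bounded_op b"
  shows "bounded_op (\<lambda>x. a x - b x)"
  using assms by (simp add: bounded_op_def bounded_linear_sub scaleC_diff_right)

lemma selfadjoint_op_diff:
  assumes "selfadjoint_op a" "selfadjoint_op b"
  shows "selfadjoint_op (\<lambda>x. a x - b x)"
  using assms
  by (simp add: selfadjoint_op_def bounded_op_diff cinner_diff_left cinner_diff_right)

lemma selfadjoint_op_inner:
  assumes "selfadjoint_op a"
  shows "inner (a x) y = inner x (a y)"
  using assms by (simp add: selfadjoint_op_def flip: Re_cinner)

lemma positive_op_inner:
  assumes "positive_op a"
  shows "0 \<le> inner x (a x)"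
  using assms by (simp add: positive_op_def Re_cinner)

lemma invertible_op_inv:
  assumes "invertible_op h"
  shows "bounded_op (inv h)" and "h (inv h x) = x"
proof -
  obtain b where b: "bounded_op b" "h \<circ> b = id" "b \<circ> h = id"
    using assms by (auto simp: invertible_op_def)
  have "inv h = b"
    using b(2,3) by (rule inv_unique_comp)
  with b show "bounded_op (inv h)" "h (inv h x) = x"
    by (simp_all add: pointfree_idE)
qed

lemma selfadjoint_op_inv:
  assumes "selfadjoint_op h" "invertible_op h"
  shows "selfadjoint_op (inv h)"
  unfolding selfadjoint_op_def
proof (intro conjI allI)
  fix x y
  have "cinner (h (inv h x)) (inv h y) = cinner (inv h x) (h (inv h y))"
    using assms(1) unfolding selfadjoint_op_def by blast
  then show "cinner (inv h x) y = cinner x (inv h y)"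
    by (simp add: invertible_op_inv(2)[OF assms(2)])
qed (rule invertible_op_inv(1)[OF assms(2)])

section \<open>Coercivity\<close>

text \<open>
  The quadratic \<open>\<langle>x + t y, a (x + t y)\<rangle>\<close> in the real variable \<open>t\<close> is nonnegative, so its
  discriminant is not positive.
\<close>

lemma positive_op_Cauchy_Schwarz:
  assumes "positive_op a"
  shows "(inner (a x) y)\<^sup>2 \<le> inner x (a x) * inner y (a y)"
proof -
  have sa: "selfadjoint_op a" and bl: "bounded_linear a"
    using assms by (auto simp: positive_op_def selfadjoint_op_def bounded_op_def)
  interpret bounded_linear a by (rule bl)
  define A B C where "A = inner x (a x)" and "B = inner (a x) y" and "C = inner y (a y)"
  have quad: "0 \<le> A + 2 * t * B + t\<^sup>2 * C" for t
  proof -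
    have "inner x (a y) = B"
      by (simp add: B_def selfadjoint_op_inner[OF sa])
    moreover have "inner y (a x) = B"
      unfolding B_def by (rule inner_commute)
    ultimately have "inner (x + t *\<^sub>R y) (a (x + t *\<^sub>R y)) = A + 2 * t * B + t\<^sup>2 * C"
      by (simp add: add scaleR inner_add_left inner_add_right A_def C_def
          power2_eq_square algebra_simps)
    with positive_op_inner[OF assms, of "x + t *\<^sub>R y"] show ?thesis
      by simp
  qed
  have "B\<^sup>2 \<le> A * C"
  proof (cases "C = 0")
    case True
    have "B = 0"
    proof (rule ccontr)
      assume "B \<noteq> 0"
      then show False
        using quad[of "- (A + 1) / (2 * B)"] True by (simp add: field_simps)
    qed
    then show ?thesis
      using True by simp
  next
    case False
    then have "C > 0"
      using positive_op_inner[OF assms, of y] by (simp add: C_def)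
    then show ?thesis
      using quad[of "- B / C"] by (simp add: field_simps power2_eq_square)
  qed
  then show ?thesis
    by (simp add: A_def B_def C_def)
qed

text \<open>
  Testing the Cauchy-Schwarz inequality of the form \<open>\<langle>h x, y\<rangle>\<close> with \<open>y = h\<^sup>-\<^sup>1 x\<close> gives
  \<open>\<parallel>x\<parallel>\<^sup>4 \<le> \<langle>x, h x\<rangle> \<langle>h\<^sup>-\<^sup>1 x, x\<rangle>\<close>, so \<open>c\<close> can be the reciprocal of any
  positive bound for the norm of \<open>h\<^sup>-\<^sup>1\<close>.
\<close>

lemma positive_invertible_coercive:
  assumes "positive_op h" "invertible_op h"
  obtains c where "c > 0" "\<And>x. c * (norm x)\<^sup>2 \<le> inner x (h x)"
proof -
  have sa: "selfadjoint_op h"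
    using assms by (simp add: positive_op_def)
  obtain K where K: "K > 0" "\<And>x. norm (inv h x) \<le> norm x * K"
    using bounded_linear.pos_bounded invertible_op_inv(1)[OF assms(2)]
    unfolding bounded_op_def by blast
  have "(1 / K) * (norm x)\<^sup>2 \<le> inner x (h x)" for x
  proof (cases "x = 0")
    case False
    let ?y = "inv h x"
    have hy: "h ?y = x"
      by (rule invertible_op_inv(2)[OF assms(2)])
    have "((norm x)\<^sup>2)\<^sup>2 = (inner (h x) ?y)\<^sup>2"
      by (simp add: selfadjoint_op_inner[OF sa] hy power2_norm_eq_inner)
    also have "\<dots> \<le> inner x (h x) * inner ?y x"
      using positive_op_Cauchy_Schwarz[OF assms(1), of x ?y] by (simp add: hy)
    also have "\<dots> \<le> inner x (h x) * (K * (norm x)\<^sup>2)"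
    proof (rule mult_left_mono)
      have "inner ?y x \<le> norm ?y * norm x"
        by (rule norm_cauchy_schwarz)
      also have "\<dots> \<le> norm x * K * norm x"
        by (intro mult_right_mono K) simp
      finally show "inner ?y x \<le> K * (norm x)\<^sup>2"
        by (simp add: power2_eq_square mult_ac)
    qed (rule positive_op_inner[OF assms(1)])
    finally have "(norm x)\<^sup>2 * (norm x)\<^sup>2 \<le> (inner x (h x) * K) * (norm x)\<^sup>2"
      by (simp add: power2_eq_square mult_ac)
    then have "(norm x)\<^sup>2 \<le> inner x (h x) * K"
      by (rule mult_right_le_imp_le) (use False in simp)
    then show ?thesis
      using K(1) by (simp add: field_simps)
  qed simp
  then show thesis
    using K(1) by (intro that[of "1 / K"]) simp_all
qed

text \<open>
  A solution of \<open>a x = y\<close> is a fixed point of \<open>x \<mapsto> x - r (a x - y)\<close>, and coercivity makes this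
  map a contraction for small \<open>r > 0\<close>:
  \<open>\<parallel>z - r a z\<parallel>\<^sup>2 \<le> (1 - 2 r c + r\<^sup>2 M\<^sup>2) \<parallel>z\<parallel>\<^sup>2\<close> if \<open>M\<close> bounds \<open>a\<close>.
\<close>

lemma coercive_surj:
  fixes a :: "'a::{real_inner, complete_space} \<Rightarrow> 'a"
  assumes "bounded_linear a" "c > 0" "\<And>x. c * (norm x)\<^sup>2 \<le> inner x (a x)"
  shows "surj a"
  unfolding surj_def
proof
  fix y
  interpret bounded_linear a by (rule assms(1))
  obtain M0 where M0: "\<And>x. norm (a x) \<le> norm x * M0"
    using bounded by blast
  \<comment> \<open>Taking the bound at least \<open>c\<close> makes it positive and \<open>q\<close> below nonnegative.\<close>
  define M where "M = max M0 c"
  have M: "norm (a x) \<le> norm x * M" for x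
    by (rule order_trans[OF M0]) (simp add: M_def mult_left_mono)
  have "M > 0" "c \<le> M"
    using assms(2) by (simp_all add: M_def)
  \<comment> \<open>This \<open>r\<close> minimises \<open>1 - 2 r c + r\<^sup>2 M\<^sup>2\<close>; the minimum is \<open>q\<close>.\<close>
  define r where "r = c / M\<^sup>2"
  define q where "q = 1 - c\<^sup>2 / M\<^sup>2"
  have "r > 0"
    using assms(2) \<open>M > 0\<close> by (simp add: r_def)
  have q: "0 \<le> q" "q < 1"
    using assms(2) \<open>M > 0\<close> \<open>c \<le> M\<close> by (simp_all add: q_def power_mono)
  have rate: "1 - 2 * r * c + r\<^sup>2 * M\<^sup>2 = q"
    using \<open>M > 0\<close> by (simp add: r_def q_def field_simps power2_eq_square)
  have contr: "norm (z - r *\<^sub>R a z) \<le> sqrt q * norm z" for z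
  proof -
    have "(norm (z - r *\<^sub>R a z))\<^sup>2 = (norm z)\<^sup>2 - 2 * r * inner z (a z) + r\<^sup>2 * (norm (a z))\<^sup>2"
      by (simp add: power2_norm_eq_inner inner_diff_left inner_diff_right
          inner_commute[of "a z" z] algebra_simps) (simp add: power2_eq_square)
    also have "\<dots> \<le> (norm z)\<^sup>2 - 2 * r * (c * (norm z)\<^sup>2) + r\<^sup>2 * (norm z * M)\<^sup>2"
      using \<open>r > 0\<close> assms(3)[of z] M[of z]
      by (intro add_mono diff_mono mult_left_mono power_mono) simp_all
    also have "\<dots> = (1 - 2 * r * c + r\<^sup>2 * M\<^sup>2) * (norm z)\<^sup>2"
      by (simp add: algebra_simps power_mult_distrib)
    finally have "(norm (z - r *\<^sub>R a z))\<^sup>2 \<le> (sqrt q * norm z)\<^sup>2"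
      using q by (simp add: rate power_mult_distrib)
    then show ?thesis
      by (rule power2_le_imp_le) (simp add: q)
  qed
  have "\<exists>!x. x \<in> UNIV \<and> x - r *\<^sub>R (a x - y) = x"
  proof (rule Banach_fix[where c = "sqrt q"])
    show "dist (x - r *\<^sub>R (a x - y)) (z - r *\<^sub>R (a z - y)) \<le> sqrt q * dist x z" for x z
    proof -
      have "(x - r *\<^sub>R (a x - y)) - (z - r *\<^sub>R (a z - y)) = (x - z) - r *\<^sub>R a (x - z)"
        by (simp add: diff algebra_simps)
      then show ?thesis
        using contr[of "x - z"] by (simp only: dist_norm)
    qed
  qed (use q in \<open>auto simp: complete_UNIV\<close>)
  then obtain x where "x - r *\<^sub>R (a x - y) = x"
    by blast
  then show "\<exists>x. y = a x"
    using \<open>r > 0\<close> by auto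
qed

section \<open>The inverse of a compression\<close>

lemma compression_solvable:
  assumes "projection_op p" "positive_op h" "invertible_op h"
  obtains u where "p u = u" "p (h u) = p x"
proof -
  have p: "selfadjoint_op p" "bounded_linear p" and pp: "p (p y) = p y" for y
    using assms(1)
    by (auto simp: projection_op_def selfadjoint_op_def bounded_op_def fun_eq_iff)
  have h: "bounded_linear h"
    using assms(3) by (simp add: invertible_op_def bounded_op_def)
  obtain c where c: "c > 0" "\<And>x. c * (norm x)\<^sup>2 \<le> inner x (h x)"
    using positive_invertible_coercive[OF assms(2,3)] by blast
  interpret p: bounded_linear p by (rule p(2))
  \<comment> \<open>Adding \<open>1 - p\<close> turns the compression of \<open>h\<close> into an operator that is coercive on the
    whole space.\<close>
  define a where "a y = p (h (p y)) + (y - p y)" for y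
  have "surj a"
  proof (rule coercive_surj)
    show "bounded_linear a"
      unfolding a_def
      by (intro bounded_linear_add bounded_linear_sub bounded_linear_ident p
          bounded_linear_compose[OF p(2)] bounded_linear_compose[OF h])
    show "min c 1 > 0"
      using c(1) by simp
    fix y
    have orth: "inner (p y) (y - p y) = 0"
      by (simp add: selfadjoint_op_inner[OF p(1)] p.diff pp)
    then have "(norm y)\<^sup>2 = (norm (p y))\<^sup>2 + (norm (y - p y))\<^sup>2"
      using norm_add_Pythagorean[of "p y" "y - p y"] by (simp add: orthogonal_def)
    then have "min c 1 * (norm y)\<^sup>2 = min c 1 * (norm (p y))\<^sup>2 + min c 1 * (norm (y - p y))\<^sup>2"
      by (simp add: distrib_left)
    also have "\<dots> \<le> c * (norm (p y))\<^sup>2 + 1 * (norm (y - p y))\<^sup>2"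
      by (intro add_mono mult_right_mono) simp_all
    also have "\<dots> \<le> inner (p y) (h (p y)) + inner (y - p y) (y - p y)"
      using c(2)[of "p y"] by (simp add: power2_norm_eq_inner)
    also have "\<dots> = inner y (a y)"
      using orth
      by (simp add: a_def inner_add_right inner_diff_left inner_diff_right
          selfadjoint_op_inner[OF p(1)] pp)
    finally show "min c 1 * (norm y)\<^sup>2 \<le> inner y (a y)" .
  qed
  then obtain w where w: "a w = p x"
    by (metis surj_def)
  have "p (h (p w)) = p (a w)"
    by (simp add: a_def p.add p.diff pp)
  then show thesis
    using that[of "p w"] by (simp add: w pp)
qed

text \<open>
  This turns the choice made by \<open>inv_into\<close> into two equations, from which linearity and symmetry
  can be read off. A solution is unique because \<open>\<langle>d, h d\<rangle> = \<langle>d, p h d\<rangle>\<close> for \<open>d\<close> in the range of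
  \<open>p\<close>, so that \<open>p h d = 0\<close> forces \<open>d = 0\<close> by coercivity.
\<close>

lemma compression_inverse_eq_iff:
  assumes "projection_op p" "positive_op h" "invertible_op h"
  shows "compression_inverse p h x = u \<longleftrightarrow> p u = u \<and> p (h u) = p x"
proof -
  have p: "selfadjoint_op p" "bounded_linear p" and pp: "p (p y) = p y" for y
    using assms(1)
    by (auto simp: projection_op_def selfadjoint_op_def bounded_op_def fun_eq_iff)
  interpret p: bounded_linear p by (rule p(2))
  interpret h: bounded_linear h
    using assms(3) by (simp add: invertible_op_def bounded_op_def)
  obtain c where c: "c > 0" "\<And>x. c * (norm x)\<^sup>2 \<le> inner x (h x)"
    using positive_invertible_coercive[OF assms(2,3)] by blast
  have inj: "inj_on (p \<circ> h \<circ> p) (range p)"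
  proof (rule inj_onI)
    fix y z assume "y \<in> range p" "z \<in> range p" and eq: "(p \<circ> h \<circ> p) y = (p \<circ> h \<circ> p) z"
    then have y: "p y = y" and z: "p z = z"
      by (auto simp: pp)
    have "inner (y - z) (h (y - z)) = inner (p (y - z)) (h (y - z))"
      by (simp add: p.diff y z)
    also have "\<dots> = inner (y - z) (p (h (y - z)))"
      by (rule selfadjoint_op_inner[OF p(1)])
    also have "\<dots> = 0"
      using eq by (simp add: h.diff p.diff y z)
    finally have "c * (norm (y - z))\<^sup>2 \<le> 0"
      using c(2)[of "y - z"] by simp
    then show "y = z"
      using c(1) by (simp add: mult_le_0_iff)
  qed
  have sol: "compression_inverse p h x = v" if "p v = v" "p (h v) = p x" for v
    unfolding compression_inverse_def
    using that by (intro inv_into_f_eq[OF inj]) (auto intro: range_eqI[of _ _ v])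
  obtain v where v: "p v = v" "p (h v) = p x"
    by (rule compression_solvable[OF assms])
  show ?thesis
    using sol[OF v] v sol[of u] by auto
qed

text \<open>
  Both \<open>\<langle>u, y\<rangle>\<close> and \<open>\<langle>x, v\<rangle>\<close>, for the images \<open>u\<close>, \<open>v\<close> of \<open>x\<close>, \<open>y\<close>, reduce to \<open>\<langle>u, h v\<rangle>\<close>, and
  boundedness follows from \<open>c \<parallel>u\<parallel>\<^sup>2 \<le> \<langle>u, h u\<rangle> = \<langle>u, x\<rangle>\<close>.
\<close>

lemma selfadjoint_op_compression_inverse:
  assumes "projection_op p" "positive_op h" "invertible_op h"
  shows "selfadjoint_op (compression_inverse p h)"
proof -
  define C where "C = compression_inverse p h"
  have C_eq_iff: "C x = u \<longleftrightarrow> p u = u \<and> p (h u) = p x" for x u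
    unfolding C_def by (rule compression_inverse_eq_iff[OF assms])
  have C: "p (C x) = C x" "p (h (C x)) = p x" for x
    using C_eq_iff[of x "C x"] by simp_all
  have p: "cinner (p x) y = cinner x (p y)" "bounded_linear p" "p (k *\<^sub>C x) = k *\<^sub>C p x" for x y k
    using assms(1) by (auto simp: projection_op_def selfadjoint_op_def bounded_op_def)
  have h: "cinner (h x) y = cinner x (h y)" "bounded_linear h" "h (k *\<^sub>C x) = k *\<^sub>C h x" for x y k
    using assms(2) by (auto simp: positive_op_def selfadjoint_op_def bounded_op_def)
  interpret p: bounded_linear p by (rule p(2))
  interpret h: bounded_linear h by (rule h(2))
  have form: "cinner (C x) y = cinner (C x) (h (C y))" for x y
    by (metis C p(1))
  obtain c where c: "c > 0" "\<And>x. c * (norm x)\<^sup>2 \<le> inner x (h x)"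
    using positive_invertible_coercive[OF assms(2,3)] by blast
  have "selfadjoint_op C"
    unfolding selfadjoint_op_def
  proof (intro conjI allI)
    show "bounded_op C"
    proof (rule bounded_op_intro)
      show "C (x + y) = C x + C y" for x y
        by (simp add: C_eq_iff p.add h.add C)
      show "C (k *\<^sub>C x) = k *\<^sub>C C x" for k x
        by (simp add: C_eq_iff p(3) h(3) C)
      show "norm (C x) \<le> norm x * (1 / c)" for x
      proof (cases "C x = 0")
        case False
        have "c * (norm (C x))\<^sup>2 \<le> inner (C x) x"
          using c(2)[of "C x"] form[of x x] by (metis Re_cinner)
        also have "\<dots> \<le> norm (C x) * norm x"
          by (rule norm_cauchy_schwarz)
        finally have "norm (C x) * (c * norm (C x)) \<le> norm (C x) * norm x"
          by (simp add: power2_eq_square mult_ac)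
        then have "c * norm (C x) \<le> norm x"
          using False by simp
        then show ?thesis
          using c(1) by (simp add: field_simps)
      qed (use c(1) in simp)
    qed
    show "cinner (C x) y = cinner x (C y)" for x y
      by (metis form h(1) cinner_commute)
  qed
  then show ?thesis
    by (simp add: C_def)
qed

section \<open>The inequality\<close>

theorem lemma0p2:
  fixes p h :: "'a::complex_hilbert_space \<Rightarrow> 'a"
  assumes "projection_op p"
    and "positive_op h"
    and "invertible_op h"
  shows "compression_inverse p h \<le>\<^sub>o\<^sub>p inv h"
proof -
  have p: "selfadjoint_op p" and h: "selfadjoint_op h"
    using assms by (simp_all add: projection_op_def positive_op_def)
  interpret h: bounded_linear h
    using assms(3) by (simp add: invertible_op_def bounded_op_def)
  have sa: "selfadjoint_op (compression_inverse p h)" "selfadjoint_op (inv h)"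
    using selfadjoint_op_compression_inverse[OF assms] selfadjoint_op_inv[OF h assms(3)] .
  have "0 \<le> inner x (inv h x - compression_inverse p h x)" for x
  proof -
    define u v where "u = compression_inverse p h x" and "v = inv h x"
    have u: "p u = u" "p (h u) = p x"
      using compression_inverse_eq_iff[OF assms, of x u] by (simp_all add: u_def)
    have hv: "h v = x"
      unfolding v_def by (rule invertible_op_inv(2)[OF assms(3)])
    have "inner u (h u) = inner u x"
      by (metis u selfadjoint_op_inner[OF p])
    moreover have "inner v (h u) = inner x u"
      by (metis hv selfadjoint_op_inner[OF h])
    ultimately have "inner (v - u) (h (v - u)) = inner x (v - u)"
      by (simp add: h.diff hv inner_diff_left inner_diff_right inner_commute)
    then show ?thesis
      using positive_op_inner[OF assms(2), of "v - u"] by (simp add: u_def v_def)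
  qed
  then show ?thesis
    using sa selfadjoint_op_diff[OF sa(2,1)]
    by (simp add: op_le_def positive_op_def Re_cinner)
qed

end
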